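(* Let $M\ge1$ and $K\ge2$ be integers, let $0<a_1\le a_2\le\cdots\le a_K$ be weights with corresponding subspace dimensions given by positive integers $\{d_k\}_{k=1}^K$, and let $0<\lambda_1\le\cdots\le\lambda_M$ be eigenvalues. Let the doubly indexed family $\{a_{k,j}\}_{k=1,j=1}^{K,\,d_k}$, $a_{k,j}=a_k$, represent each $a_k$ repeated $d_k$ times, and let $N=\sum_{k=1}^K d_k$. Suppose there is an ordering $\{a_n\}_{n=1}^N$ of $\{a_{k,j}\}_{k=1,j=1}^{K,\,d_k}$ such that (a) $\sum_{n=1}^Na_n^2=\sum_{m=1}^M\lambda_m$; (b) $a_{K-1}^2+a_K^2\le\lambda_1$; (c) whenever $a_\ell=a_{k,j}$ and $a_{\ell'}=a_{k',j'}$ (as entries of the ordering) with $k=k'$ and $\ell<\ell'$, then $\sum_{n=\ell}^{\ell'-1}a_n^2\ge2\lambda_M$. Then STC/STR, run on $\{a_n\}_{n=1}^N$ and $\{\lambda_m\}_{m=1}^M$ (in this order), builds a weighted fusion frame $\{W_k,a_k\}_{k=1}^K$ for $\mathbb{R}^M$ with $\dim W_k=d_k$ for all $k$, whose fusion frame operator has spectrum $\{\lambda_m\}_{m=1}^M$ (with multiplicity).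
   Context: Fusion frames. For subspaces $W_k\subseteq\mathbb{R}^M$ and weights $\nu_k>0$, $\{W_k,\nu_k\}_{k=1}^K$ is a fusion frame for $\mathbb{R}^M$ if there are $0<A\le B<\infty$ with $A\|f\|^2\le\sum_k\nu_k^2\|P_kf\|^2\le B\|f\|^2$ for all $f$, where $P_k$ is the orthogonal projection onto $W_k$; its fusion frame operator is $\sum_k\nu_k^2P_k$. STC/STR (spectral tetris construction with re-ordering). Input: positive norms $(a_1,\dots,a_N)$, each entry carrying its label (double index), and positive eigenvalues $(\lambda_1,\dots,\lambda_M)$ with $\sum a_n^2=\sum\lambda_m$. Let $e_1,\dots,e_M$ be the standard basis of $\mathbb{R}^M$. Start with row $m=1$, column $n=1$, remaining value $\rho=\lambda_1$, and repeat until all columns are used: 1. If $\rho=0$: pass to row $m+1$ with $\rho=\lambda_{m+1}$. 2. If $\rho\ge a_n^2$ (and $\rho>0$): set $f_n=a_ne_m$, replace $\rho$ by $\rho-a_n^2$ and $n$ by $n+1$. 3. If $0<\rho<a_n^2$ and $\rho>a_{n+1}^2$: interchange the entries $a_n$ and $a_{n+1}$ of the norm sequence (together with their labels), then perform step 2. 4. If $0<\rho<a_n^2$ and $\rho\le a_{n+1}^2$: with $x=\rho$, $y=a_n^2+a_{n+1}^2-x$, set $$f_n=\sqrt{\tfrac{x(a_n^2-y)}{x-y}}\,e_m+\sqrt{\tfrac{y(x-a_n^2)}{x-y}}\,e_{m+1},\qquad f_{n+1}=\sqrt{\tfrac{x(x-a_n^2)}{x-y}}\,e_m-\sqrt{\tfrac{y(a_n^2-y)}{x-y}}\,e_{m+1},$$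 pass to row $m+1$ with $\rho=\lambda_{m+1}-y$ and replace $n$ by $n+2$ (this requires $y\le\lambda_{m+1}$). Each output vector inherits the label $(k,j)$ of the norm of its column in the final ordering, so that the output can be written $\{f_{k,j}\}_{k=1,j=1}^{K,d_k}$. That STC/STR builds a fusion frame $\{W_k,a_k\}_{k=1}^K$ means that the procedure runs to completion and that, with $W_k=\operatorname{span}\{f_{k,j}\}_{j=1}^{d_k}$, the family $\{W_k,a_k\}_{k=1}^K$ is a fusion frame with the stated properties. *)

theory Defs
  imports "HOL-Analysis.Analysis"
begin

definition orth_proj :: "'a::euclidean_space set \<Rightarrow> 'a \<Rightarrow> 'a" where
  "orth_proj W x = (THE p. p \<in> W \<and> x - p \<in> orthogonal_comp W)"

definition fusion_frame :: "'k set \<Rightarrow> ('k \<Rightarrow> 'a::euclidean_space set) \<Rightarrow> ('k \<Rightarrow> real) \<Rightarrow> bool" where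
  "fusion_frame I W v \<longleftrightarrow>
     finite I \<and> (\<forall>k\<in>I. subspace (W k) \<and> 0 < v k) \<and>
     (\<exists>A B. 0 < A \<and> A \<le> B \<and>
        (\<forall>f. A * (norm f)\<^sup>2 \<le> (\<Sum>k\<in>I. (v k)\<^sup>2 * (norm (orth_proj (W k) f))\<^sup>2) \<and>
             (\<Sum>k\<in>I. (v k)\<^sup>2 * (norm (orth_proj (W k) f))\<^sup>2) \<le> B * (norm f)\<^sup>2))"

definition fusion_frame_operator ::
    "'k set \<Rightarrow> ('k \<Rightarrow> 'a::euclidean_space set) \<Rightarrow> ('k \<Rightarrow> real) \<Rightarrow> 'a \<Rightarrow> 'a" where
  "fusion_frame_operator I W v f = (\<Sum>k\<in>I. (v k)\<^sup>2 *\<^sub>R orth_proj (W k) f)"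

(* The multiplicity of an eigenvalue is the dimension of its eigenspace; for the self-adjoint
   operators considered here it agrees with the algebraic multiplicity. Real numbers that do not
   occur among lam 1, ..., lam M are forced to have a trivial eigenspace. *)
definition has_spectrum :: "('a::euclidean_space \<Rightarrow> 'a) \<Rightarrow> nat \<Rightarrow> (nat \<Rightarrow> real) \<Rightarrow> bool" where
  "has_spectrum T M lam \<longleftrightarrow>
     linear T \<and> (\<forall>\<mu>. dim {f. T f = \<mu> *\<^sub>R f} = card {m \<in> {1..M}. lam m = \<mu>})"

(* The loop of STC/STR in state (m, rho), m being the current row (counted from 1) and rho the
   remaining value. The last argument lists the unused columns a_n, a_{n+1}, ... in their current
   order, each norm paired with its label, so that an interchange of a_n and a_{n+1} acts on the
   first two list entries. The result lists the columns f_n, f_{n+1}, ... with the labels they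
   inherit. It is None if the procedure gets stuck: a row beyond M or a column a_{n+1} is
   required but does not exist, or the condition y \<le> lam (m+1) fails. *)
function stc_str_loop ::
    "(nat \<Rightarrow> 'a::real_vector) \<Rightarrow> nat \<Rightarrow> (nat \<Rightarrow> real) \<Rightarrow> nat \<Rightarrow> real \<Rightarrow> (real \<times> 'l) list
      \<Rightarrow> ('l \<times> 'a) list option" where
  "stc_str_loop e M lam m \<rho> [] = Some []"
| "stc_str_loop e M lam m \<rho> ((a, i) # cs) =
    (if \<rho> = 0 then
       (if m < M then stc_str_loop e M lam (Suc m) (lam (Suc m)) ((a, i) # cs) else None)
     else if 0 < \<rho> \<and> a\<^sup>2 \<le> \<rho> then
       map_option (\<lambda>fs. (i, a *\<^sub>R e m) # fs) (stc_str_loop e M lam m (\<rho> - a\<^sup>2) cs)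
     else
       (case cs of
          [] \<Rightarrow> None
        | (b, j) # cs' \<Rightarrow>
            if 0 < \<rho> \<and> b\<^sup>2 < \<rho> then
              map_option (\<lambda>fs. (j, b *\<^sub>R e m) # fs)
                (stc_str_loop e M lam m (\<rho> - b\<^sup>2) ((a, i) # cs'))
            else
              (let x = \<rho>; y = a\<^sup>2 + b\<^sup>2 - x in
               if 0 < \<rho> \<and> m < M \<and> y \<le> lam (Suc m) then
                 map_option
                   (\<lambda>fs.
                     (i, sqrt (x * (a\<^sup>2 - y) / (x - y)) *\<^sub>R e m
                         + sqrt (y * (x - a\<^sup>2) / (x - y)) *\<^sub>R e (Suc m)) #
                     (j, sqrt (x * (x - a\<^sup>2) / (x - y)) *\<^sub>R e m
                         - sqrt (y * (a\<^sup>2 - y) / (x - y)) *\<^sub>R e (Suc m)) # fs)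
                   (stc_str_loop e M lam (Suc m) (lam (Suc m) - y) cs')
               else None)))"
  by pat_completeness auto
termination
  by (relation "measures [\<lambda>(e, M, lam, m, \<rho>, cs). M - m, \<lambda>(e, M, lam, m, \<rho>, cs). length cs]") auto

definition stc_str ::
    "(nat \<Rightarrow> 'a::real_vector) \<Rightarrow> nat \<Rightarrow> (nat \<Rightarrow> real) \<Rightarrow> (real \<times> 'l) list \<Rightarrow> ('l \<times> 'a) list option" where
  "stc_str e M lam cs = stc_str_loop e M lam 1 (lam 1) cs"

definition label_span :: "((nat \<times> nat) \<times> 'a::real_vector) list \<Rightarrow> nat \<Rightarrow> 'a set" where
  "label_span out k = span {f. \<exists>j. ((k, j), f) \<in> set out}"

end

(* The columns f produced in a run satisfy sum f f^T = diag lam: a 2 x 2 block splits its two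
   squared norms into x on row m and y on row m + 1 with orthogonal rows. So once equally labelled
   columns are known to be pairwise orthogonal, a_k^2 P_k is the sum of f f^T over group k, and
   the fusion frame operator is diag lam.
   Orthogonality and completion both come from the gap condition (c). An interchange only moves
   the first unused column, delaying it by a total mass D with D + rho < a_n^2 <= lam 1, while
   columns of equal label are 2 lam M apart. This rules out a block with two columns of the same
   group (so y <= a_g^2 + a_h^2 <= lam 1 by (b)), and it makes the run leave the rows touched by
   a column before the next column of the same group is reached. *)

theory Submission
  imports Defs
begin

section \<open>Algebra of the two-row blocks\<close>

text \<open>Since \<open>y = A + (B - x)\<close>, we get \<open>x < A \<le> y\<close> and
  \<open>A - y = x - B \<le> 0\<close>, so every radicand is a quotient of a nonpositive number by a
  negative one. In order, the conclusions are the two row sums, the two column sums and the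
  orthogonality of the rows; in the last one both sides are the root of the same product.\<close>

lemma block_coeffs:
  fixes x y A B :: real
  assumes "0 < x" "x < A" "x \<le> B" and y: "y = A + B - x"
  shows "(sqrt (x * (A - y) / (x - y)))\<^sup>2 + (sqrt (x * (x - A) / (x - y)))\<^sup>2 = x"
    and "(sqrt (y * (x - A) / (x - y)))\<^sup>2 + (sqrt (y * (A - y) / (x - y)))\<^sup>2 = y"
    and "(sqrt (x * (A - y) / (x - y)))\<^sup>2 + (sqrt (y * (x - A) / (x - y)))\<^sup>2 = A"
    and "(sqrt (x * (x - A) / (x - y)))\<^sup>2 + (sqrt (y * (A - y) / (x - y)))\<^sup>2 = B"
    and "sqrt (x * (A - y) / (x - y)) * sqrt (y * (x - A) / (x - y)) =
         sqrt (x * (x - A) / (x - y)) * sqrt (y * (A - y) / (x - y))"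
proof -
  have neg: "x - y < 0" and "0 < y" and le: "A - y \<le> 0" "x - A \<le> 0"
    using assms by auto
  have nonneg: "0 \<le> x * (A - y) / (x - y)" "0 \<le> x * (x - A) / (x - y)"
    "0 \<le> y * (x - A) / (x - y)" "0 \<le> y * (A - y) / (x - y)"
    using neg \<open>0 < x\<close> \<open>0 < y\<close> le
    by (auto intro!: divide_nonpos_neg mult_nonneg_nonpos)
  note sq = real_sqrt_pow2[OF nonneg(1)] real_sqrt_pow2[OF nonneg(2)]
    real_sqrt_pow2[OF nonneg(3)] real_sqrt_pow2[OF nonneg(4)]
  show "(sqrt (x * (A - y) / (x - y)))\<^sup>2 + (sqrt (x * (x - A) / (x - y)))\<^sup>2 = x"
    "(sqrt (y * (x - A) / (x - y)))\<^sup>2 + (sqrt (y * (A - y) / (x - y)))\<^sup>2 = y"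
    "(sqrt (x * (A - y) / (x - y)))\<^sup>2 + (sqrt (y * (x - A) / (x - y)))\<^sup>2 = A"
    unfolding sq using neg by (simp_all add: divide_simps) (simp_all add: algebra_simps)
  have "x * (x - A) + y * (A - y) = B * (x - y)"
    unfolding y by (simp add: algebra_simps)
  then show "(sqrt (x * (x - A) / (x - y)))\<^sup>2 + (sqrt (y * (A - y) / (x - y)))\<^sup>2 = B"
    unfolding sq using neg by (simp add: add_divide_distrib[symmetric])
  show "sqrt (x * (A - y) / (x - y)) * sqrt (y * (x - A) / (x - y)) =
         sqrt (x * (x - A) / (x - y)) * sqrt (y * (A - y) / (x - y))"
    unfolding real_sqrt_mult[symmetric] by (simp add: mult_ac)
qed

text \<open>After expansion both mixed terms carry the coefficient \<open>p * q - r * s\<close>, so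
  orthogonal rows make the sum of the two rank-one operators diagonal in \<open>u\<close>,
  \<open>w\<close>.\<close>

lemma rank_one_pair_sum:
  fixes u w v :: "'a::real_inner"
  assumes "p * q = r * s"
  shows "((p *\<^sub>R u + q *\<^sub>R w) \<bullet> v) *\<^sub>R (p *\<^sub>R u + q *\<^sub>R w)
       + ((r *\<^sub>R u - s *\<^sub>R w) \<bullet> v) *\<^sub>R (r *\<^sub>R u - s *\<^sub>R w)
       = ((p\<^sup>2 + r\<^sup>2) * (u \<bullet> v)) *\<^sub>R u + ((q\<^sup>2 + s\<^sup>2) * (w \<bullet> v)) *\<^sub>R w" (is "?l = _")
proof -
  have "?l = ((p\<^sup>2 + r\<^sup>2) * (u \<bullet> v) + (p * q - r * s) * (w \<bullet> v)) *\<^sub>R u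
           + ((q\<^sup>2 + s\<^sup>2) * (w \<bullet> v) + (p * q - r * s) * (u \<bullet> v)) *\<^sub>R w"
    by (simp add: inner_add_left inner_diff_left power2_eq_square algebra_simps)
  then show ?thesis using assms by simp
qed

section \<open>The gap condition as a recursive predicate on lists\<close>

text \<open>Each column with a label in group \<open>k\<close> is preceded in the list by columns whose squared
  norms add up to at least \<open>t\<close>.\<close>
primrec late :: "('k \<Rightarrow> real) \<Rightarrow> ('k \<times> 'j) list \<Rightarrow> 'k \<Rightarrow> real \<Rightarrow> bool" where
  "late a [] k t = True"
| "late a (i # ls) k t = ((fst i = k \<longrightarrow> t \<le> 0) \<and> late a ls k (t - (a (fst i))\<^sup>2))"

text \<open>The sum in condition (c) includes the earlier of the two columns, whereas
  \<open>late\<close> starts counting behind it; hence \<open>c\<close> is lowered by the squared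
  norm of the head.\<close>

primrec gaps :: "('k \<Rightarrow> real) \<Rightarrow> real \<Rightarrow> ('k \<times> 'j) list \<Rightarrow> bool" where
  "gaps a c [] = True"
| "gaps a c (i # ls) = (late a ls (fst i) (c - (a (fst i))\<^sup>2) \<and> gaps a c ls)"

lemma late_mono: "late a ls k t \<Longrightarrow> t' \<le> t \<Longrightarrow> late a ls k t'"
  by (induction ls arbitrary: t t') force+

lemma late_map_upt:
  assumes "\<And>l. l \<in> {p..<q} \<Longrightarrow> fst (\<sigma> l) = k \<Longrightarrow> t \<le> (\<Sum>n=p..<l. (a (fst (\<sigma> n)))\<^sup>2)"
  shows "late a (map \<sigma> [p..<q]) k t"
  using assms
proof (induction "q - p" arbitrary: p t)
  case (Suc n)
  then have "p < q" by simp
  have "late a (map \<sigma> [Suc p..<q]) k (t - (a (fst (\<sigma> p)))\<^sup>2)"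
  proof (rule Suc.hyps)
    fix l assume l: "l \<in> {Suc p..<q}" "fst (\<sigma> l) = k"
    then have "t \<le> (\<Sum>n=p..<l. (a (fst (\<sigma> n)))\<^sup>2)"
      by (intro Suc.prems) auto
    also have "\<dots> = (a (fst (\<sigma> p)))\<^sup>2 + (\<Sum>n=Suc p..<l. (a (fst (\<sigma> n)))\<^sup>2)"
      using l by (simp add: sum.atLeast_Suc_lessThan)
    finally show "t - (a (fst (\<sigma> p)))\<^sup>2 \<le> (\<Sum>n=Suc p..<l. (a (fst (\<sigma> n)))\<^sup>2)" by simp
  qed (use Suc.hyps in simp)
  moreover have "fst (\<sigma> p) = k \<longrightarrow> t \<le> 0"
    using Suc.prems[of p] \<open>p < q\<close> by simp
  ultimately show ?case
    using \<open>p < q\<close> by (simp add: upt_conv_Cons)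
qed simp

lemma gaps_map_upt:
  assumes "\<And>l l'. p \<le> l \<Longrightarrow> l < l' \<Longrightarrow> l' < q \<Longrightarrow> fst (\<sigma> l) = fst (\<sigma> l') \<Longrightarrow>
             c \<le> (\<Sum>n=l..<l'. (a (fst (\<sigma> n)))\<^sup>2)"
  shows "gaps a c (map \<sigma> [p..<q])"
  using assms
proof (induction "q - p" arbitrary: p)
  case (Suc n)
  then have "p < q" by simp
  have "late a (map \<sigma> [Suc p..<q]) (fst (\<sigma> p)) (c - (a (fst (\<sigma> p)))\<^sup>2)"
  proof (rule late_map_upt)
    fix l assume l: "l \<in> {Suc p..<q}" "fst (\<sigma> l) = fst (\<sigma> p)"
    then have "c \<le> (\<Sum>n=p..<l. (a (fst (\<sigma> n)))\<^sup>2)"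
      by (intro Suc.prems) auto
    also have "\<dots> = (a (fst (\<sigma> p)))\<^sup>2 + (\<Sum>n=Suc p..<l. (a (fst (\<sigma> n)))\<^sup>2)"
      using l by (simp add: sum.atLeast_Suc_lessThan)
    finally show "c - (a (fst (\<sigma> p)))\<^sup>2 \<le> (\<Sum>n=Suc p..<l. (a (fst (\<sigma> n)))\<^sup>2)" by simp
  qed
  moreover have "gaps a c (map \<sigma> [Suc p..<q])"
    using Suc by (intro Suc.hyps) auto
  ultimately show ?case
    using \<open>p < q\<close> by (simp add: upt_conv_Cons)
qed simp

section \<open>Successful runs: support, norms and the sum of rank-one operators\<close>

text \<open>The orderings of weights and eigenvalues are used in this form: \<open>a_sq_pair\<close>
  is condition (b) carried over to any two distinct groups, and \<open>lam 1\<close>,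
  \<open>lam M\<close> are the extreme eigenvalues.\<close>

locale tetris =
  fixes M :: nat and lam :: "nat \<Rightarrow> real" and e :: "nat \<Rightarrow> 'a::real_inner"
    and G :: "'k set" and a :: "'k \<Rightarrow> real"
  assumes e_inner: "i \<in> {1..M} \<Longrightarrow> j \<in> {1..M} \<Longrightarrow> e i \<bullet> e j = (if i = j then 1 else 0)"
    and a_pos: "k \<in> G \<Longrightarrow> 0 < a k"
    and a_sq_le: "k \<in> G \<Longrightarrow> (a k)\<^sup>2 \<le> lam 1"
    and a_sq_pair: "k \<in> G \<Longrightarrow> g \<in> G \<Longrightarrow> k \<noteq> g \<Longrightarrow> (a k)\<^sup>2 + (a g)\<^sup>2 \<le> lam 1"
    and lam_pos: "0 < lam 1"
    and lam_ge: "m \<in> {1..M} \<Longrightarrow> lam 1 \<le> lam m"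
    and lam_le: "m \<in> {1..M} \<Longrightarrow> lam m \<le> lam M"
begin

abbreviation w :: "'k \<times> 'j \<Rightarrow> real" where
  "w i \<equiv> a (fst i)"

text \<open>One rule per successful branch of \<open>stc_str_loop\<close>, so that facts about the
  output follow by rule induction. \<open>finish\<close> leaves \<rho> open; the mass balance
  assumed in \<open>run_frame\<close> forces it to be 0.\<close>

inductive run :: "nat \<Rightarrow> real \<Rightarrow> ('k \<times> 'j) list \<Rightarrow> (('k \<times> 'j) \<times> 'a) list \<Rightarrow> bool" where
  finish: "run m \<rho> [] []"
| next_row: "m < M \<Longrightarrow> run (Suc m) (lam (Suc m)) ls out \<Longrightarrow> run m 0 ls out"
| place: "0 < \<rho> \<Longrightarrow> (w i)\<^sup>2 \<le> \<rho> \<Longrightarrow> run m (\<rho> - (w i)\<^sup>2) ls out \<Longrightarrow>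
    run m \<rho> (i # ls) ((i, w i *\<^sub>R e m) # out)"
| swap: "0 < \<rho> \<Longrightarrow> \<rho> < (w i)\<^sup>2 \<Longrightarrow> (w j)\<^sup>2 < \<rho> \<Longrightarrow> run m (\<rho> - (w j)\<^sup>2) (i # ls) out \<Longrightarrow>
    run m \<rho> (i # j # ls) ((j, w j *\<^sub>R e m) # out)"
| block: "0 < \<rho> \<Longrightarrow> \<rho> < (w i)\<^sup>2 \<Longrightarrow> \<rho> \<le> (w j)\<^sup>2 \<Longrightarrow> m < M \<Longrightarrow> y = (w i)\<^sup>2 + (w j)\<^sup>2 - \<rho> \<Longrightarrow>
    y \<le> lam (Suc m) \<Longrightarrow> run (Suc m) (lam (Suc m) - y) ls out \<Longrightarrow>
    run m \<rho> (i # j # ls)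
      ((i, sqrt (\<rho> * ((w i)\<^sup>2 - y) / (\<rho> - y)) *\<^sub>R e m
           + sqrt (y * (\<rho> - (w i)\<^sup>2) / (\<rho> - y)) *\<^sub>R e (Suc m)) #
       (j, sqrt (\<rho> * (\<rho> - (w i)\<^sup>2) / (\<rho> - y)) *\<^sub>R e m
           - sqrt (y * ((w i)\<^sup>2 - y) / (\<rho> - y)) *\<^sub>R e (Suc m)) # out)"

text \<open>The row index never decreases, and a step only writes to the current row and the next
  one.\<close>

lemma run_support:
  assumes "run m \<rho> ls out" "1 \<le> m" "m \<le> M" "(i, f) \<in> set out" "1 \<le> n" "n < m"
  shows "f \<bullet> e n = 0"
  using assms
  by (induction arbitrary: i f rule: run.induct)
    (fastforce simp: e_inner inner_add_left inner_diff_left)+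

lemma run_norm:
  assumes "run m \<rho> ls out" "1 \<le> m" "m \<le> M" "(i, f) \<in> set out"
  shows "f \<bullet> f = (w i)\<^sup>2"
  using assms
proof (induction arbitrary: i f rule: run.induct)
  case (block \<rho> i' j' m y ls out)
  note c = block_coeffs[OF block.hyps(1-3,5)]
  have IH: "(i, f) \<in> set out \<Longrightarrow> f \<bullet> f = (w i)\<^sup>2"
    using block.IH block.prems block.hyps(4) by simp
  have norms: "(p *\<^sub>R e m + q *\<^sub>R e (Suc m)) \<bullet> (p *\<^sub>R e m + q *\<^sub>R e (Suc m)) = p\<^sup>2 + q\<^sup>2"
    "(p *\<^sub>R e m - q *\<^sub>R e (Suc m)) \<bullet> (p *\<^sub>R e m - q *\<^sub>R e (Suc m)) = p\<^sup>2 + q\<^sup>2" for p q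
    using block.prems block.hyps(4)
    by (simp_all add: e_inner inner_add_left inner_diff_left inner_add_right inner_diff_right
        power2_eq_square)
  show ?case
    using block.prems(3) unfolding list.set insert_iff prod.inject
    by (elim disjE conjE) (simp_all only: norms c(3,4) IH)
qed (auto simp: e_inner power2_eq_square)

text \<open>Interchanges permute the columns; equality of multisets is enough to transfer both
  distinctness and the set of labels.\<close>

lemma run_labels:
  assumes "run m \<rho> ls out"
  shows "mset (map fst out) = mset ls"
  using assms by (induction rule: run.induct) auto

text \<open>Row \<open>m\<close> still has to receive \<rho> and every later row its whole
  eigenvalue; each step subtracts what its columns contribute. The mass balance ensures that nothing
  is left to receive once the columns run out.\<close>

lemma run_frame:
  assumes "run m \<rho> ls out" "1 \<le> m" "m \<le> M" "0 \<le> \<rho>"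
    and "(\<Sum>i\<leftarrow>ls. (w i)\<^sup>2) = \<rho> + (\<Sum>n=Suc m..M. lam n)"
  shows "(\<Sum>p\<leftarrow>out. (snd p \<bullet> v) *\<^sub>R snd p) =
    (\<rho> * (e m \<bullet> v)) *\<^sub>R e m + (\<Sum>n=Suc m..M. (lam n * (e n \<bullet> v)) *\<^sub>R e n)"
  using assms
proof (induction rule: run.induct)
  case (finish m \<rho>)
  have pos: "0 < lam n" if "n \<in> {Suc m..M}" for n
    using lam_ge[of n] lam_pos that finish by auto
  then have "0 \<le> (\<Sum>n=Suc m..M. lam n)" by (intro sum_nonneg) (auto intro: less_imp_le)
  with finish have z: "\<rho> = 0" "(\<Sum>n=Suc m..M. lam n) = 0" by auto
  \<comment> \<open>Eigenvalues are positive, so a remaining row would make the sum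
    positive.\<close>
  have "{Suc m..M} = {}"
    using sum_pos[of "{Suc m..M}" lam] pos z by fastforce
  with z show ?case by simp
next
  case (next_row m ls out)
  then have "0 \<le> lam (Suc m)" using lam_ge[of "Suc m"] lam_pos by auto
  with next_row show ?case by (simp add: sum.atLeast_Suc_atMost[of "Suc m"])
next
  case (block \<rho> i j m y ls out)
  note c = block_coeffs[OF block.hyps(1-3,5)]
  have "(\<Sum>i\<leftarrow>ls. (w i)\<^sup>2) = lam (Suc m) - y + (\<Sum>n=Suc (Suc m)..M. lam n)"
    using block by (simp add: sum.atLeast_Suc_atMost[of "Suc m"])
  with block have IH: "(\<Sum>p\<leftarrow>out. (snd p \<bullet> v) *\<^sub>R snd p) =
      ((lam (Suc m) - y) * (e (Suc m) \<bullet> v)) *\<^sub>R e (Suc m) +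
      (\<Sum>n=Suc (Suc m)..M. (lam n * (e n \<bullet> v)) *\<^sub>R e n)"
    by simp
  \<comment> \<open>The block puts \<open>y\<close> on row \<open>Suc m\<close> and the rest of the
    run puts \<open>lam (Suc m) - y\<close> there.\<close>
  show ?case
    using block.hyps(4)
    by (simp only: list.map sum_list.Cons snd_conv add.assoc[symmetric]
        rank_one_pair_sum[OF c(5)] c(1,2) IH)
      (simp add: sum.atLeast_Suc_atMost[of "Suc m"] algebra_simps)
qed (auto simp: power2_eq_square algebra_simps)

text \<open>Placing a column lowers \<rho> and the threshold of \<open>late\<close> equally. The
  surplus \<open>lam 1 - (a k)\<^sup>2\<close> covers the lookahead by one column in an interchange
  or a block: by \<open>a_sq_pair\<close> it bounds the squared norm of a column of another group
  standing in front. Once the row is left, \<open>run_support\<close> applies.\<close>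

lemma run_late:
  assumes "run m \<rho> ls out" "1 \<le> m" "m \<le> M" "fst ` set ls \<subseteq> G"
    and "k \<in> G" "late a ls k (\<rho> + lam 1 - (a k)\<^sup>2)" "(i, f) \<in> set out" "fst i = k"
  shows "f \<bullet> e m = 0"
  using assms
proof (induction arbitrary: i f rule: run.induct)
  case (next_row m ls out)
  then show ?case using run_support[of "Suc m" _ ls out i f m] by simp
next
  case (place \<rho> i' m ls out)
  have "fst i' \<noteq> k"
    using place a_sq_le[of k] by auto
  then show ?case
    using place by (cases i) (auto simp: algebra_simps)
next
  case (swap \<rho> i' j' m ls out)
  have i': "fst i' \<noteq> k"
    using swap a_sq_le[of k] by auto
  then have "fst j' \<noteq> k"
    using swap a_sq_pair[of k "fst i'"] by auto
  then show ?case
    using swap i' by (cases i) (auto simp: algebra_simps)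
next
  case (block \<rho> i' j' m y ls out)
  have i': "fst i' \<noteq> k"
    using block a_sq_le[of k] by auto
  then have "fst j' \<noteq> k"
    using block a_sq_pair[of k "fst i'"] by auto
  with i' have "(i, f) \<in> set out" using block by auto
  then show ?case
    using run_support[OF block.hyps(7), of i f m] block by simp
qed simp

section \<open>The invariant of a run, and completion\<close>

text \<open>\<open>D\<close> is the mass that interchanges in the current row have already put in front of the
  first column; only that column can be short of the full gap.\<close>
definition spread :: "nat \<Rightarrow> real \<Rightarrow> ('k \<times> 'j) list \<Rightarrow> bool" where
  "spread m \<rho> ls \<longleftrightarrow> 1 \<le> m \<and> m \<le> M \<and> fst ` set ls \<subseteq> G \<and> 0 \<le> \<rho> \<and> \<rho> \<le> lam m \<and>
     (case ls of [] \<Rightarrow> True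
      | i # ls' \<Rightarrow> gaps a (2 * lam M) ls' \<and>
          (\<exists>D\<ge>0. late a ls' (fst i) (2 * lam M - D - (w i)\<^sup>2) \<and> D + \<rho> \<le> lam m \<and>
             (D = 0 \<or> 0 < \<rho> \<and> D + \<rho> < (w i)\<^sup>2)))"

lemma spread_gaps:
  assumes "gaps a (2 * lam M) ls" "1 \<le> m" "m \<le> M" "fst ` set ls \<subseteq> G" "0 \<le> \<rho>" "\<rho> \<le> lam m"
  shows "spread m \<rho> ls"
  using assms unfolding spread_def by (auto split: list.splits intro!: exI[of _ 0])

text \<open>At remaining value 0 the last clause of \<open>spread\<close> forces
  \<open>D = 0\<close>, so the first column has its full gap.\<close>

lemma spread_next_row:
  assumes "spread m 0 ls" "m < M"
  shows "spread (Suc m) (lam (Suc m)) ls"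
  using assms lam_ge[of "Suc m"] lam_pos
  by (intro spread_gaps) (auto simp: spread_def split: list.splits)

lemma spread_place:
  assumes "spread m \<rho> (i # ls)" "(w i)\<^sup>2 \<le> \<rho>"
  shows "spread m (\<rho> - (w i)\<^sup>2) ls"
  using assms by (intro spread_gaps) (auto simp: spread_def intro: order_trans[of _ \<rho>])

text \<open>The new witness is \<open>D + (w j)\<^sup>2\<close>. An interchange thus preserves
  \<open>D + \<rho>\<close>, and strictness of \<open>(w j)\<^sup>2 < \<rho>\<close> keeps the
  remaining value positive.\<close>

lemma spread_swap:
  assumes "spread m \<rho> (i # j # ls)" "\<rho> < (w i)\<^sup>2" "(w j)\<^sup>2 < \<rho>"
  shows "spread m (\<rho> - (w j)\<^sup>2) (i # ls)"
proof -
  obtain D where D: "0 \<le> D" "late a (j # ls) (fst i) (2 * lam M - D - (w i)\<^sup>2)" "D + \<rho> \<le> lam m"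
    "D = 0 \<or> 0 < \<rho> \<and> D + \<rho> < (w i)\<^sup>2"
    using assms(1) unfolding spread_def by auto
  have "late a ls (fst i) (2 * lam M - (D + (w j)\<^sup>2) - (w i)\<^sup>2)"
    using D(2) by (simp add: algebra_simps)
  moreover have "\<rho> - (w j)\<^sup>2 \<le> lam m"
    using assms(1) unfolding spread_def by (auto intro: order_trans[of _ \<rho>])
  ultimately show ?thesis
    using assms D unfolding spread_def by (auto intro!: exI[of _ "D + (w j)\<^sup>2"])
qed

text \<open>Equal groups would force \<open>2 * lam M \<le> D + (w i)\<^sup>2\<close>, but
  \<open>D < lam M\<close> because \<rho> is positive, and
  \<open>(w i)\<^sup>2 \<le> lam M\<close>.\<close>

lemma spread_pair:
  assumes "spread m \<rho> (i # j # ls)" "0 < \<rho>"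
  shows "fst i \<noteq> fst j"
proof
  assume "fst i = fst j"
  then obtain D where "2 * lam M - D - (w i)\<^sup>2 \<le> 0" "D + \<rho> \<le> lam m"
    using assms(1) unfolding spread_def by auto
  moreover have "lam m \<le> lam M" "(w i)\<^sup>2 \<le> lam M"
    using assms(1) lam_le[of m] lam_ge[of M] a_sq_le[of "fst i"] unfolding spread_def by auto
  ultimately show False using assms(2) by linarith
qed

text \<open>The two columns lie in different groups, so \<open>a_sq_pair\<close> bounds
  \<open>y\<close> by \<open>lam 1\<close>. The delayed column leaves the list, and its
  \<open>D\<close> with it.\<close>

lemma spread_block:
  assumes "spread m \<rho> (i # j # ls)" "0 < \<rho>" "\<rho> < (w i)\<^sup>2" "\<rho> \<le> (w j)\<^sup>2" "m < M"
    and y: "y = (w i)\<^sup>2 + (w j)\<^sup>2 - \<rho>"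
  shows "y \<le> lam (Suc m)" and "spread (Suc m) (lam (Suc m) - y) ls"
proof -
  have "(w i)\<^sup>2 + (w j)\<^sup>2 \<le> lam 1"
    using spread_pair[OF assms(1,2)] assms(1) unfolding spread_def by (intro a_sq_pair) auto
  then show *: "y \<le> lam (Suc m)"
    using lam_ge[of "Suc m"] assms by auto
  show "spread (Suc m) (lam (Suc m) - y) ls"
    using * assms by (intro spread_gaps) (auto simp: spread_def)
qed

text \<open>Every step passes to a new row or uses up a column, so \<open>M - m + length ls\<close>
  decreases. The mass balance provides the next row and the second column where they are required;
  \<open>spread_block\<close> provides the bound on \<open>y\<close>.\<close>

lemma loop_run:
  assumes "spread m \<rho> ls" "(\<Sum>i\<leftarrow>ls. (w i)\<^sup>2) = \<rho> + (\<Sum>n=Suc m..M. lam n)"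
  shows "\<exists>out. stc_str_loop e M lam m \<rho> (map (\<lambda>i. (w i, i)) ls) = Some out \<and> run m \<rho> ls out"
  using assms
proof (induction "M - m + length ls" arbitrary: m \<rho> ls rule: less_induct)
  case less
  note sp = less.prems(1) and total = less.prems(2)
  have m: "1 \<le> m" "m \<le> M" and "0 \<le> \<rho>" using sp unfolding spread_def by auto
  have split_row: "(\<Sum>n=Suc m..M. lam n) = lam (Suc m) + (\<Sum>n=Suc (Suc m)..M. lam n)"
    if "m < M"
    using that by (simp add: sum.atLeast_Suc_atMost[of "Suc m"])
  have rest: "0 \<le> (\<Sum>n=Suc r..M. lam n)" for r
  proof (rule sum_nonneg)
    fix n assume "n \<in> {Suc r..M}"
    then show "0 \<le> lam n" using lam_ge[of n] lam_pos by auto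
  qed
  show ?case
  proof (cases ls)
    case Nil
    then show ?thesis by (auto intro: finish)
  next
    case (Cons i ls')
    have iG: "fst i \<in> G" using sp Cons unfolding spread_def by auto
    then have wi: "0 < (w i)\<^sup>2" using a_pos by fastforce
    have ls'_nonneg: "0 \<le> (\<Sum>i\<leftarrow>ls'. (w i)\<^sup>2)" by (intro sum_list_nonneg) auto
    consider (zero) "\<rho> = 0" | (place) "0 < \<rho>" "(w i)\<^sup>2 \<le> \<rho>" | (small) "0 < \<rho>" "\<rho> < (w i)\<^sup>2"
      using \<open>0 \<le> \<rho>\<close> by linarith
    then show ?thesis
    proof cases
      case zero
      \<comment> \<open>In the last row the remaining columns would have total mass 0, yet column
        \<open>i\<close> has positive mass.\<close>
      have "m < M"
      proof (rule ccontr)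
        assume "\<not> m < M"
        then show False using total zero Cons wi ls'_nonneg by simp
      qed
      then have "M - Suc m + length ls < M - m + length ls" by simp
      then obtain out where
        "stc_str_loop e M lam (Suc m) (lam (Suc m)) (map (\<lambda>i. (w i, i)) ls) = Some out"
        "run (Suc m) (lam (Suc m)) ls out"
        using less.hyps[of "Suc m" ls "lam (Suc m)"] spread_next_row[of m ls] sp zero
          total split_row \<open>m < M\<close> by auto
      then show ?thesis
        using zero \<open>m < M\<close> Cons by (auto intro: next_row)
    next
      case place
      then obtain out where
        "stc_str_loop e M lam m (\<rho> - (w i)\<^sup>2) (map (\<lambda>i. (w i, i)) ls') = Some out"
        "run m (\<rho> - (w i)\<^sup>2) ls' out"
        using less.hyps[of m ls' "\<rho> - (w i)\<^sup>2"] spread_place[of m \<rho> i ls'] sp total Cons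
        by auto
      then show ?thesis
        using place Cons by (auto intro: run.place)
    next
      case small
      have "m < M"
      proof (rule ccontr)
        assume "\<not> m < M"
        then show False using total small Cons ls'_nonneg by simp
      qed
      \<comment> \<open>A single last column would have to carry \<rho> and all of
        \<open>lam (Suc m)\<close>, exceeding the bound \<open>lam 1\<close> on its squared
        norm.\<close>
      have "ls' \<noteq> []"
      proof
        assume "ls' = []"
        then have "lam (Suc m) < (w i)\<^sup>2"
          using total Cons small split_row[OF \<open>m < M\<close>] rest[of "Suc m"] by simp
        then show False
          using a_sq_le[OF iG] lam_ge[of "Suc m"] \<open>m < M\<close> by simp
      qed
      then obtain j ls'' where ls: "ls = i # j # ls''"
        using Cons by (cases ls') auto
      show ?thesis
      proof (cases "(w j)\<^sup>2 < \<rho>")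
        case True
        then obtain out where
          "stc_str_loop e M lam m (\<rho> - (w j)\<^sup>2) (map (\<lambda>i. (w i, i)) (i # ls'')) = Some out"
          "run m (\<rho> - (w j)\<^sup>2) (i # ls'') out"
          using less.hyps[of m "i # ls''" "\<rho> - (w j)\<^sup>2"] spread_swap[of m \<rho> i j ls'']
            sp total ls small by auto
        then show ?thesis
          using small True ls by (auto intro: swap)
      next
        case False
        define y where "y = (w i)\<^sup>2 + (w j)\<^sup>2 - \<rho>"
        note bl = spread_block[OF sp[unfolded ls] small _ \<open>m < M\<close> y_def]
        have "M - Suc m + length ls'' < M - m + length ls" using ls \<open>m < M\<close> by simp
        moreover have "(\<Sum>i\<leftarrow>ls''. (w i)\<^sup>2) = lam (Suc m) - y + (\<Sum>n=Suc (Suc m)..M. lam n)"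
          using total split_row[OF \<open>m < M\<close>] ls by (simp add: y_def)
        ultimately obtain out where
          "stc_str_loop e M lam (Suc m) (lam (Suc m) - y) (map (\<lambda>i. (w i, i)) ls'') = Some out"
          "run (Suc m) (lam (Suc m) - y) ls'' out"
          using less.hyps[of "Suc m" ls'' "lam (Suc m) - y"] bl(2) False by fastforce
        then show ?thesis
          using small False ls \<open>m < M\<close> bl(1) run.block[OF small _ \<open>m < M\<close> y_def]
          by (auto simp: Let_def y_def[symmetric])
      qed
    qed
  qed
qed

text \<open>Each column is compared with those produced after it: the invariant gives the threshold
  that \<open>run_late\<close> asks for at the state after the step.\<close>

lemma run_orthogonal:
  assumes "run m \<rho> ls out" "spread m \<rho> ls"
  shows "sorted_wrt (\<lambda>p q. fst (fst p) = fst (fst q) \<longrightarrow> snd p \<bullet> snd q = 0) out"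
  using assms
proof (induction rule: run.induct)
  case (finish m \<rho>)
  then show ?case by simp
next
  case (next_row m ls out)
  then show ?case using spread_next_row by blast
next
  case (place \<rho> i m ls out)
  note sp = place.prems
  have m: "1 \<le> m" "m \<le> M" "fst ` set ls \<subseteq> G" "fst i \<in> G"
    using sp unfolding spread_def by auto
  obtain D where D: "late a ls (fst i) (2 * lam M - D - (w i)\<^sup>2)" "D + \<rho> \<le> lam m"
    using sp unfolding spread_def by auto
  have bounds: "lam m \<le> lam M" "lam 1 \<le> lam M"
    using lam_le[of m] lam_ge[of M] m by auto
  \<comment> \<open>Here \<open>D + \<rho> \<le> lam m \<le> lam M\<close> and
    \<open>lam 1 \<le> lam M\<close> pay for the two halves of the gap.\<close>
  have "late a ls (fst i) (\<rho> - (w i)\<^sup>2 + lam 1 - (w i)\<^sup>2)"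
    using D(1) by (rule late_mono)
      (use D(2) bounds zero_le_power2[of "w i"] in linarith)
  then have "e m \<bullet> f = 0" if "(l, f) \<in> set out" "fst l = fst i" for l f
    using run_late[OF place.hyps(3) m(1,2,3,4) _ that] by (auto simp: inner_commute)
  moreover have "sorted_wrt (\<lambda>p q. fst (fst p) = fst (fst q) \<longrightarrow> snd p \<bullet> snd q = 0) out"
    using place.IH spread_place[OF sp place.hyps(2)] by blast
  ultimately show ?case by auto
next
  case (swap \<rho> i j m ls out)
  note sp = swap.prems
  have m: "1 \<le> m" "m \<le> M" "fst ` set (i # ls) \<subseteq> G" "fst j \<in> G" "\<rho> \<le> lam m"
    and gap: "late a ls (fst j) (2 * lam M - (w j)\<^sup>2)"
    using sp unfolding spread_def by auto
  have bounds: "lam m \<le> lam M" "lam 1 \<le> lam M"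
    using lam_le[of m] lam_ge[of M] m by auto
  \<comment> \<open>The extra \<open>(w i)\<^sup>2\<close> is subtracted because the delayed column
    \<open>i\<close> still stands in front of \<open>ls\<close>.\<close>
  have "late a ls (fst j) (\<rho> - (w j)\<^sup>2 + lam 1 - (w j)\<^sup>2 - (w i)\<^sup>2)"
    using gap by (rule late_mono)
      (use bounds m(5) zero_le_power2[of "w i"] zero_le_power2[of "w j"] in linarith)
  moreover have "fst i \<noteq> fst j"
    using spread_pair[OF sp] swap.hyps by blast
  ultimately have "late a (i # ls) (fst j) (\<rho> - (w j)\<^sup>2 + lam 1 - (w j)\<^sup>2)" by simp
  then have "e m \<bullet> f = 0" if "(l, f) \<in> set out" "fst l = fst j" for l f
    using run_late[OF swap.hyps(4) m(1,2,3,4) _ that] by (auto simp: inner_commute)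
  moreover have "sorted_wrt (\<lambda>p q. fst (fst p) = fst (fst q) \<longrightarrow> snd p \<bullet> snd q = 0) out"
    using swap.IH spread_swap[OF sp swap.hyps(2,3)] by blast
  ultimately show ?case by auto
next
  case (block \<rho> i j m y ls out)
  note sp = block.prems and y = block.hyps(5)
  have m: "1 \<le> m" "Suc m \<le> M" "fst ` set ls \<subseteq> G" "fst i \<in> G" "fst j \<in> G" "\<rho> \<le> lam m"
    and gap_j: "late a ls (fst j) (2 * lam M - (w j)\<^sup>2)"
    using sp block.hyps unfolding spread_def by auto
  obtain D where D: "late a ls (fst i) (2 * lam M - D - (w i)\<^sup>2 - (w j)\<^sup>2)"
    "D = 0 \<or> D + \<rho> < (w i)\<^sup>2"
    using sp unfolding spread_def by auto
  have bounds: "lam (Suc m) \<le> lam M" "lam 1 \<le> lam M"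
    using lam_le[of "Suc m"] lam_ge[of M] m by auto
  \<comment> \<open>After inserting \<open>y\<close> this reduces to \<open>lam (Suc m) + lam 1 + D
    + \<rho> - (w i)\<^sup>2 \<le> 2 * lam M\<close>, which is where
    \<open>D + \<rho> < (w i)\<^sup>2\<close> enters.\<close>
  have "late a ls (fst i) (lam (Suc m) - y + lam 1 - (w i)\<^sup>2)"
    using D(1) by (rule late_mono) (use D(2) block.hyps(2) y bounds in linarith)
  moreover have "late a ls (fst j) (lam (Suc m) - y + lam 1 - (w j)\<^sup>2)"
    using gap_j by (rule late_mono)
      (use block.hyps(2) y bounds zero_le_power2[of "w j"] in linarith)
  ultimately have "e (Suc m) \<bullet> f = 0" if "(l, f) \<in> set out" "fst l = fst i \<or> fst l = fst j" for l f
    using run_late[OF block.hyps(7) _ m(2,3) _ _ that(1)] m(4,5) that(2) by (auto simp: inner_commute)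
  moreover have "e m \<bullet> f = 0" if "(l, f) \<in> set out" for l f
    using run_support[OF block.hyps(7) _ _ that] m by (simp add: inner_commute)
  moreover have "sorted_wrt (\<lambda>p q. fst (fst p) = fst (fst q) \<longrightarrow> snd p \<bullet> snd q = 0) out"
    using block.IH spread_block(2)[OF sp block.hyps(1-5)] by blast
  \<comment> \<open>The two columns of a block share both rows; being in different groups, they are
    not compared with each other.\<close>
  moreover have "fst i \<noteq> fst j"
    using spread_pair[OF sp block.hyps(1)] .
  ultimately show ?case
    by (auto simp: inner_add_left inner_diff_left)
qed

end

section \<open>Orthogonal projections\<close>

text \<open>For a second candidate \<open>q\<close>, the vector \<open>q - p\<close> of
  \<open>W\<close> is orthogonal to both residuals, hence to their difference, which is
  \<open>q - p\<close> itself.\<close>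

lemma orth_proj_eqI:
  assumes "subspace W" "p \<in> W" "x - p \<in> orthogonal_comp W"
  shows "orth_proj W x = p"
  unfolding orth_proj_def
proof (rule the_equality)
  fix q assume q: "q \<in> W \<and> x - q \<in> orthogonal_comp W"
  have W: "q - p \<in> W" using assms q subspace_diff by blast
  have "(q - p) \<bullet> (x - p) = 0" "(q - p) \<bullet> (x - q) = 0"
    using W q assms(3) unfolding orthogonal_comp_def orthogonal_def by auto
  then have "(q - p) \<bullet> (q - p) = 0"
    by (simp add: inner_diff_right)
  then show "q = p" by simp
qed (use assms in blast)

lemma norm_orth_proj_sq:
  assumes "subspace W"
  shows "(norm (orth_proj W x))\<^sup>2 = orth_proj W x \<bullet> x"
proof -
  obtain y z where yz: "y \<in> span W" "\<And>v. v \<in> span W \<Longrightarrow> orthogonal z v" "x = y + z"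
    using orthogonal_subspace_decomp_exists[of W x] by blast
  have span: "span W = W" using assms by simp
  have "orth_proj W x = y"
    using yz unfolding span
    by (intro orth_proj_eqI assms) (auto simp: orthogonal_comp_def orthogonal_commute)
  moreover have "y \<bullet> z = 0"
    using yz(2)[OF yz(1)] by (simp add: orthogonal_def inner_commute)
  ultimately show ?thesis
    using yz(3) by (simp add: power2_norm_eq_inner inner_add_right)
qed

text \<open>The Fourier expansion over an orthogonal set; the common squared norm \<open>c\<close>
  cancels the normalising factor. With \<open>c = (a k)\<^sup>2\<close> the left side is one term of
  the fusion frame operator.\<close>

lemma orth_proj_span_orthogonal:
  fixes B :: "'a::euclidean_space set"
  assumes "finite B" "pairwise orthogonal B" and c: "\<And>b. b \<in> B \<Longrightarrow> b \<bullet> b = c" "c \<noteq> 0"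
  shows "c *\<^sub>R orth_proj (span B) x = (\<Sum>b\<in>B. (b \<bullet> x) *\<^sub>R b)"
proof -
  define p where "p = (1 / c) *\<^sub>R (\<Sum>b\<in>B. (b \<bullet> x) *\<^sub>R b)"
  have "b' \<bullet> p = b' \<bullet> x" if "b' \<in> B" for b'
  proof -
    have "b' \<bullet> (\<Sum>b\<in>B. (b \<bullet> x) *\<^sub>R b) = (\<Sum>b\<in>B. if b = b' then c * (b' \<bullet> x) else 0)"
      unfolding inner_sum_right
      using assms(2) that c(1)
      by (intro sum.cong) (auto simp: pairwise_def orthogonal_def)
    also have "\<dots> = c * (b' \<bullet> x)"
      using that assms(1) by simp
    finally show ?thesis using c(2) by (simp add: p_def)
  qed
  then have "orthogonal (x - p) b" if "b \<in> span B" for b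
    using that
    by (intro orthogonal_to_span[of b B])
      (auto simp: orthogonal_def inner_diff_left inner_diff_right inner_commute)
  moreover have "p \<in> span B"
    unfolding p_def by (intro span_scale span_sum) (simp add: span_base)
  ultimately have "orth_proj (span B) x = p"
    by (intro orth_proj_eqI) (auto simp: orthogonal_comp_def orthogonal_commute)
  then show ?thesis using c(2) by (simp add: p_def)
qed

section \<open>The subspaces spanned by the groups\<close>

lemma sorted_wrt_symp:
  assumes "sorted_wrt P xs" "symp P" "x \<in> set xs" "y \<in> set xs" "x \<noteq> y"
  shows "P x y"
  using assms by (induction xs) (auto dest: sympD)

locale group_columns =
  fixes K :: nat and a :: "nat \<Rightarrow> real"
    and out :: "((nat \<times> nat) \<times> 'a::euclidean_space) list"
  assumes labels: "distinct (map fst out)" "fst ` fst ` set out \<subseteq> {1..K}"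
    and orth: "sorted_wrt (\<lambda>p q. fst (fst p) = fst (fst q) \<longrightarrow> snd p \<bullet> snd q = 0) out"
    and norms: "\<And>i f. (i, f) \<in> set out \<Longrightarrow> f \<bullet> f = (a (fst i))\<^sup>2"
    and a_pos: "\<And>k. k \<in> {1..K} \<Longrightarrow> 0 < a k"
begin

text \<open>Labelled pairs are kept, so that columns can be counted by label before their vectors
  are known to differ.\<close>

definition columns :: "nat \<Rightarrow> ((nat \<times> nat) \<times> 'a) set" where
  "columns k = {p \<in> set out. fst (fst p) = k}"

lemma label_span_columns: "label_span out k = span (snd ` columns k)"
proof -
  have "{f. \<exists>j. ((k, j), f) \<in> set out} = snd ` columns k"
    unfolding columns_def by force
  then show ?thesis unfolding label_span_def by simp
qed

lemma columns_orthogonal: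
  assumes "p \<in> columns k" "q \<in> columns k" "p \<noteq> q"
  shows "snd p \<bullet> snd q = 0"
proof -
  have "fst (fst p) = fst (fst q) \<longrightarrow> snd p \<bullet> snd q = 0"
    by (rule sorted_wrt_symp[OF orth])
      (use assms in \<open>auto simp: columns_def symp_def inner_commute\<close>)
  then show ?thesis using assms by (simp add: columns_def)
qed

lemma columns_norm: "p \<in> columns k \<Longrightarrow> snd p \<bullet> snd p = (a k)\<^sup>2"
  using norms[of "fst p" "snd p"] by (auto simp: columns_def)

lemma columns_nonzero: "p \<in> columns k \<Longrightarrow> snd p \<noteq> 0"
  using columns_norm[of p k] a_pos[of k] labels(2) by (fastforce simp: columns_def)

text \<open>Two columns with the same vector would make a nonzero vector orthogonal to
  itself.\<close>

lemma inj_on_columns: "inj_on snd (columns k)"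
  by (rule inj_onI) (metis columns_orthogonal columns_nonzero inner_eq_zero_iff)

lemma pairwise_orthogonal_columns: "pairwise orthogonal (snd ` columns k)"
  unfolding pairwise_def orthogonal_def using columns_orthogonal by blast

lemma finite_columns: "finite (columns k)"
  by (simp add: columns_def)

lemma dim_label_span: "dim (label_span out k) = card {i \<in> set (map fst out). fst i = k}"
proof -
  have "independent (snd ` columns k)"
    using pairwise_orthogonal_columns columns_nonzero
    by (intro pairwise_orthogonal_independent) force+
  then have "dim (label_span out k) = card (columns k)"
    unfolding label_span_columns
    by (simp add: dim_eq_card_independent card_image[OF inj_on_columns])
  also have "\<dots> = card (fst ` columns k)"
    using labels(1) unfolding columns_def distinct_map
    by (intro card_image[symmetric]) (auto intro: inj_on_subset)
  also have "fst ` columns k = {i \<in> set (map fst out). fst i = k}"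
    unfolding columns_def by force
  finally show ?thesis .
qed

text \<open>Each weighted projection is the sum of rank-one operators over its group, and the groups
  partition the output. Distinct labels allow passing from the set to the list.\<close>

lemma fusion_frame_operator_columns:
  "fusion_frame_operator {1..K} (label_span out) a v = (\<Sum>p\<leftarrow>out. (snd p \<bullet> v) *\<^sub>R snd p)"
proof -
  have "(a k)\<^sup>2 *\<^sub>R orth_proj (label_span out k) v = (\<Sum>p\<in>columns k. (snd p \<bullet> v) *\<^sub>R snd p)"
    if "k \<in> {1..K}" for k
  proof -
    have "(a k)\<^sup>2 *\<^sub>R orth_proj (label_span out k) v = (\<Sum>b\<in>snd ` columns k. (b \<bullet> v) *\<^sub>R b)"
      unfolding label_span_columns
      by (rule orth_proj_span_orthogonal)
        (use a_pos[OF that] finite_columns pairwise_orthogonal_columns columns_norm in auto)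
    then show ?thesis by (simp add: sum.reindex[OF inj_on_columns])
  qed
  then have "fusion_frame_operator {1..K} (label_span out) a v =
      (\<Sum>k=1..K. \<Sum>p\<in>columns k. (snd p \<bullet> v) *\<^sub>R snd p)"
    unfolding fusion_frame_operator_def by simp
  also have "\<dots> = (\<Sum>p\<in>set out. (snd p \<bullet> v) *\<^sub>R snd p)"
    unfolding columns_def using labels(2) by (intro sum.group) auto
  also have "\<dots> = (\<Sum>p\<leftarrow>out. (snd p \<bullet> v) *\<^sub>R snd p)"
    using labels(1) by (intro sum.distinct_set_conv_list) (simp add: distinct_map)
  finally show ?thesis .
qed

end

text \<open>Turns the frame inequalities into bounds on a quadratic form.\<close>

lemma inner_fusion_frame_operator:
  assumes "\<And>k. k \<in> I \<Longrightarrow> subspace (W k)"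
  shows "(\<Sum>k\<in>I. (v k)\<^sup>2 * (norm (orth_proj (W k) f))\<^sup>2) = fusion_frame_operator I W v f \<bullet> f"
  unfolding fusion_frame_operator_def inner_sum_left
  by (intro sum.cong) (simp_all add: norm_orth_proj_sq assms)

section \<open>Diagonal operators in the standard basis\<close>

context
  fixes e :: "nat \<Rightarrow> 'a::euclidean_space" and M :: nat and lam :: "nat \<Rightarrow> real"
  assumes e: "bij_betw e {1..M} Basis"
begin

lemma inner_basis_enum:
  assumes "i \<in> {1..M}" "j \<in> {1..M}"
  shows "e i \<bullet> e j = (if i = j then 1 else 0)"
proof -
  have "e i \<in> Basis" "e j \<in> Basis" "e i = e j \<longleftrightarrow> i = j"
    using assms e by (auto simp: bij_betw_def inj_on_eq_iff)
  then show ?thesis by (simp add: inner_Basis)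
qed

lemma diagonal_inner_basis:
  assumes "n \<in> {1..M}"
  shows "e n \<bullet> (\<Sum>m=1..M. (lam m * (e m \<bullet> f)) *\<^sub>R e m) = lam n * (e n \<bullet> f)"
proof -
  have "e n \<bullet> (\<Sum>m=1..M. (lam m * (e m \<bullet> f)) *\<^sub>R e m) =
      (\<Sum>m=1..M. if m = n then lam n * (e n \<bullet> f) else 0)"
    unfolding inner_sum_right using assms by (intro sum.cong) (auto simp: inner_basis_enum)
  then show ?thesis using assms by simp
qed

text \<open>Comparing coordinates, an eigenvector for \<mu> vanishes at each \<open>e n\<close> with
  \<open>lam n \<noteq> \<mu>\<close>. The eigenspace is thus a coordinate subspace, trivial if
  \<mu> does not occur.\<close>

lemma has_spectrum_diagonal:
  "has_spectrum (\<lambda>f. \<Sum>m=1..M. (lam m * (e m \<bullet> f)) *\<^sub>R e m) M lam" (is "has_spectrum ?T M lam")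
  unfolding has_spectrum_def
proof (intro conjI allI)
  show "linear ?T"
    by (intro linearI)
      (simp_all add: inner_add_right distrib_left scaleR_add_left sum.distrib scaleR_sum_right
        mult.left_commute)
  fix \<mu>
  let ?E = "{m \<in> {1..M}. lam m = \<mu>}"
  have Basis: "Basis = e ` {1..M}" and inj: "inj_on e {1..M}"
    using e by (auto simp: bij_betw_def)
  have "?T f = \<mu> *\<^sub>R f \<longleftrightarrow> (\<forall>i\<in>Basis. i \<notin> e ` ?E \<longrightarrow> f \<bullet> i = 0)" for f
  proof -
    have "?T f = \<mu> *\<^sub>R f \<longleftrightarrow> (\<forall>n\<in>{1..M}. e n \<bullet> ?T f = e n \<bullet> (\<mu> *\<^sub>R f))"
      unfolding euclidean_eq_iff[of "?T f"] unfolding Basis by (simp only: ball_simps inner_commute)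
    also have "\<dots> \<longleftrightarrow> (\<forall>n\<in>{1..M}. lam n * (e n \<bullet> f) = \<mu> * (e n \<bullet> f))"
      by (intro ball_cong refl) (simp only: diagonal_inner_basis inner_scaleR_right)
    also have "\<dots> \<longleftrightarrow> (\<forall>n\<in>{1..M}. n \<notin> ?E \<longrightarrow> f \<bullet> e n = 0)"
      by (auto simp: inner_commute)
    also have "\<dots> \<longleftrightarrow> (\<forall>i\<in>Basis. i \<notin> e ` ?E \<longrightarrow> f \<bullet> i = 0)"
    proof -
      have "e n \<in> e ` ?E \<longleftrightarrow> n \<in> ?E" if "n \<in> {1..M}" for n
        using that by (intro inj_on_image_mem_iff[OF inj]) auto
      then show ?thesis unfolding Basis ball_simps by blast
    qed
    finally show ?thesis .
  qed
  moreover have "e ` ?E \<subseteq> Basis"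
    unfolding Basis by blast
  ultimately have "dim {f. ?T f = \<mu> *\<^sub>R f} = card (e ` ?E)"
    by (simp only: dim_substandard)
  then show "dim {f. ?T f = \<mu> *\<^sub>R f} = card ?E"
    by (simp only: card_image[OF inj_on_subset[OF inj Collect_restrict]])
qed

lemma diagonal_inner_self:
  "(\<Sum>m=1..M. (lam m * (e m \<bullet> f)) *\<^sub>R e m) \<bullet> f = (\<Sum>m=1..M. lam m * (e m \<bullet> f)\<^sup>2)"
  by (simp add: inner_sum_left power2_eq_square mult.assoc)

lemma norm_sq_basis_enum: "(norm f)\<^sup>2 = (\<Sum>m=1..M. (e m \<bullet> f)\<^sup>2)"
proof -
  have "(norm f)\<^sup>2 = (\<Sum>b\<in>Basis. (b \<bullet> f)\<^sup>2)"
    unfolding power2_norm_eq_inner euclidean_inner[of f f] by (simp add: power2_eq_square inner_commute)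
  also have "\<dots> = (\<Sum>m=1..M. (e m \<bullet> f)\<^sup>2)"
    by (rule sum.reindex_bij_betw[OF e, symmetric])
  finally show ?thesis .
qed

end

section \<open>Assembling the fusion frame\<close>

theorem theorem4p2:
  fixes M K N :: nat
    and a :: "nat \<Rightarrow> real"
    and d :: "nat \<Rightarrow> nat"
    and lam :: "nat \<Rightarrow> real"
    and e :: "nat \<Rightarrow> real ^ 'm"
    and \<sigma> :: "nat \<Rightarrow> nat \<times> nat"
  assumes "CARD('m) = M" and "M \<ge> 1" and "K \<ge> 2"
    and std_basis: "bij_betw e {1..M} (Basis :: (real ^ 'm) set)"
    and weights: "0 < a 1" "\<forall>k\<in>{1..K}. \<forall>k'\<in>{1..K}. k \<le> k' \<longrightarrow> a k \<le> a k'"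
    and dims: "\<forall>k\<in>{1..K}. d k \<ge> 1"
    and eigenvalues: "0 < lam 1" "\<forall>m\<in>{1..M}. \<forall>m'\<in>{1..M}. m \<le> m' \<longrightarrow> lam m \<le> lam m'"
    and N: "N = (\<Sum>k=1..K. d k)"
    and ordering: "bij_betw \<sigma> {1..N} (SIGMA k:{1..K}. {1..d k})"
    and a: "(\<Sum>n=1..N. (a (fst (\<sigma> n)))\<^sup>2) = (\<Sum>m=1..M. lam m)"
    and b: "(a (K - 1))\<^sup>2 + (a K)\<^sup>2 \<le> lam 1"
    and c: "\<forall>l\<in>{1..N}. \<forall>l'\<in>{1..N}. fst (\<sigma> l) = fst (\<sigma> l') \<and> l < l' \<longrightarrow>
              (\<Sum>n=l..l' - 1. (a (fst (\<sigma> n)))\<^sup>2) \<ge> 2 * lam M"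
  shows "\<exists>out. stc_str e M lam (map (\<lambda>n. (a (fst (\<sigma> n)), \<sigma> n)) [1..<Suc N]) = Some out \<and>
           fusion_frame {1..K} (label_span out) a \<and>
           (\<forall>k\<in>{1..K}. dim (label_span out k) = d k) \<and>
           has_spectrum (fusion_frame_operator {1..K} (label_span out) a) M lam"
proof -
  define ls where "ls = map \<sigma> [1..<Suc N]"
  have a_pos: "0 < a k" if "k \<in> {1..K}" for k
    using weights(1) weights(2)[rule_format, of 1 k] that by fastforce
  have a_sq_mono: "(a k)\<^sup>2 \<le> (a k')\<^sup>2" if "k \<in> {1..K}" "k' \<in> {1..K}" "k \<le> k'" for k k'
    using weights(2) a_pos[of k] that by (intro power_mono) auto
  have pair: "(a k)\<^sup>2 + (a g)\<^sup>2 \<le> lam 1" if "k \<in> {1..K}" "g \<in> {1..K}" "k < g" for k g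
  proof -
    \<comment> \<open>The smaller index is at most \<open>K - 1\<close> and the larger at most
      \<open>K\<close>, so monotonicity reduces the claim to (b).\<close>
    have "k \<le> K - 1" "K - 1 \<in> {1..K}" "K \<in> {1..K}" using that \<open>K \<ge> 2\<close> by auto
    then show ?thesis
      using b a_sq_mono[of k "K - 1"] a_sq_mono[of g K] that by auto
  qed
  interpret tetris M lam e "{1..K}" a
  proof
    fix k assume k: "k \<in> {1..K}"
    show "0 < a k" using a_pos k .
    show "(a k)\<^sup>2 \<le> lam 1"
    proof -
      have "(a k)\<^sup>2 \<le> (a K)\<^sup>2" using a_sq_mono[of k K] k by simp
      then show ?thesis using b zero_le_power2[of "a (K - 1)"] by linarith
    qed
    show "(a k)\<^sup>2 + (a g)\<^sup>2 \<le> lam 1" if "g \<in> {1..K}" "k \<noteq> g" for g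
      using pair[of k g] pair[of g k] k that by (cases "k < g") auto
  qed (use inner_basis_enum[OF std_basis] eigenvalues \<open>M \<ge> 1\<close> in auto)
  have set_ls: "set ls = (SIGMA k:{1..K}. {1..d k})"
    using ordering unfolding ls_def bij_betw_def
    by (simp add: atLeastLessThanSuc_atLeastAtMost del: upt_Suc)
  have "distinct ls"
    using ordering unfolding ls_def bij_betw_def
    by (simp add: distinct_map atLeastLessThanSuc_atLeastAtMost del: upt_Suc)
  have "gaps a (2 * lam M) ls"
    unfolding ls_def
  proof (rule gaps_map_upt)
    fix l l' assume l: "1 \<le> l" "l < l'" "l' < Suc N" "fst (\<sigma> l) = fst (\<sigma> l')"
    then have "{l..l' - 1} = {l..<l'}" by auto
    then show "2 * lam M \<le> (\<Sum>n=l..<l'. (a (fst (\<sigma> n)))\<^sup>2)"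
      using c[rule_format, of l l'] l by auto
  qed
  then have spread: "spread 1 (lam 1) ls"
    using \<open>M \<ge> 1\<close> eigenvalues(1) set_ls by (intro spread_gaps) auto
  have "(\<Sum>i\<leftarrow>ls. (w i)\<^sup>2) = (\<Sum>n=1..N. (a (fst (\<sigma> n)))\<^sup>2)"
    unfolding ls_def
    by (simp add: interv_sum_list_conv_sum_set_nat comp_def atLeastLessThanSuc_atLeastAtMost
        del: upt_Suc)
  then have total: "(\<Sum>i\<leftarrow>ls. (w i)\<^sup>2) = lam 1 + (\<Sum>n=Suc 1..M. lam n)"
    using a \<open>M \<ge> 1\<close> by (simp add: sum.atLeast_Suc_atMost[of "Suc 0"])
  obtain out where
    loop: "stc_str_loop e M lam 1 (lam 1) (map (\<lambda>i. (w i, i)) ls) = Some out" and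
    run: "run 1 (lam 1) ls out"
    using loop_run[OF spread total] by blast
  have labels: "mset (map fst out) = mset ls"
    using run by (rule run_labels)
  then have set_out: "fst ` set out = set ls"
    by (metis set_map set_mset_mset)
  interpret group_columns K a out
  proof
    show "distinct (map fst out)"
      using \<open>distinct ls\<close> labels mset_eq_imp_distinct_iff by blast
    show "fst ` fst ` set out \<subseteq> {1..K}"
      unfolding set_out set_ls by auto
    show "sorted_wrt (\<lambda>p q. fst (fst p) = fst (fst q) \<longrightarrow> snd p \<bullet> snd q = 0) out"
      using run_orthogonal[OF run spread] .
    show "f \<bullet> f = (a (fst i))\<^sup>2" if "(i, f) \<in> set out" for i f
      using run_norm[OF run _ _ that] \<open>M \<ge> 1\<close> by simp
  qed (use a_pos in auto)
  have op: "fusion_frame_operator {1..K} (label_span out) a =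
      (\<lambda>f. \<Sum>m=1..M. (lam m * (e m \<bullet> f)) *\<^sub>R e m)"
    unfolding fusion_frame_operator_columns
    using run_frame[OF run _ _ _ total] eigenvalues(1) \<open>M \<ge> 1\<close>
    by (simp add: sum.atLeast_Suc_atMost[of "Suc 0"])
  have "fusion_frame {1..K} (label_span out) a"
    unfolding fusion_frame_def
  proof (intro conjI ballI exI allI)
    show subspace: "subspace (label_span out k)" for k
      by (simp add: label_span_def)
    \<comment> \<open>The extreme eigenvalues serve as frame bounds.\<close>
    show "0 < lam 1" "lam 1 \<le> lam M"
      using eigenvalues lam_ge[of M] \<open>M \<ge> 1\<close> by auto
    fix f
    have energy: "(\<Sum>k\<in>{1..K}. (a k)\<^sup>2 * (norm (orth_proj (label_span out k) f))\<^sup>2) =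
        (\<Sum>m=1..M. lam m * (e m \<bullet> f)\<^sup>2)"
      by (simp only: inner_fusion_frame_operator[OF subspace] op diagonal_inner_self[OF std_basis])
    show "lam 1 * (norm f)\<^sup>2 \<le> (\<Sum>k\<in>{1..K}. (a k)\<^sup>2 * (norm (orth_proj (label_span out k) f))\<^sup>2)"
      "(\<Sum>k\<in>{1..K}. (a k)\<^sup>2 * (norm (orth_proj (label_span out k) f))\<^sup>2) \<le> lam M * (norm f)\<^sup>2"
      unfolding energy norm_sq_basis_enum[OF std_basis, of f] sum_distrib_left
      by (intro sum_mono mult_right_mono lam_ge lam_le; simp)+
  qed (use a_pos in auto)
  moreover have "dim (label_span out k) = d k" if "k \<in> {1..K}" for k
  proof -
    have "{i \<in> set (map fst out). fst i = k} = {k} \<times> {1..d k}"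
      using that by (auto simp: set_out set_ls)
    then show ?thesis by (simp add: dim_label_span)
  qed
  moreover have "has_spectrum (fusion_frame_operator {1..K} (label_span out) a) M lam"
    unfolding op by (rule has_spectrum_diagonal[OF std_basis])
  moreover have "stc_str e M lam (map (\<lambda>n. (a (fst (\<sigma> n)), \<sigma> n)) [1..<Suc N]) = Some out"
    using loop unfolding stc_str_def ls_def by (simp add: comp_def del: upt_Suc)
  ultimately show ?thesis by blast
qed

end
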